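(* Let $\mathcal{A}$ be a normal distributive $\nabla$-algebra with underlying set $A$. Then $\mathcal{A}$ is simple if and only if for every $x\in A\setminus\{1\}$ there exist a finite set $I$ and natural numbers $m_i,n_i\in\mathbb{N}$ (for $i\in I$) satisfying $\bigwedge_{i\in I}\nabla^{m_i}\Box^{n_i}x=0$. The same equivalence also holds for any $\mathcal{A}\in\mathcal{V}_H(N)$, i.e., any normal explicitly Heyting $\nabla$-algebra.
   Context: A $\nabla$-algebra is a tuple $\mathcal{A}=(\mathsf{A},\nabla,\to)$ where $\mathsf{A}=(A,\wedge,\vee,0,1)$ is a bounded lattice, $\nabla$ is a unary and $\to$ a binary operation on $A$, such that for all $a,b,c\in A$: $\nabla c\wedge a\leq b$ iff $c\leq a\to b$. Put $\Box a := 1\to a$. $\mathcal{A}$ is distributive if $\mathsf{A}$ is a distributive lattice; it is normal if $\nabla 1=1$ and $\nabla(a\wedge b)=\nabla a\wedge\nabla b$ for all $a,b\in A$. An explicitly Heyting $\nabla$-algebra is a structure $(\mathsf{A},\nabla,\to,\supset)$ where $(\mathsf{A},\nabla,\to)$ is a $\nabla$-algebra and $\supset$ is the Heyting implication on $\mathsf{A}$; $\mathcal{V}_H(N)$ is the class of those that are normal. A congruence relation on $\mathcal{A}$ is an equivalence relation on $A$ compatible with finite meets, finite joins, $\nabla$ and $\to$ (for explicitly Heyting $\nabla$-algebras, compatibility with $\supset$ is not required in the definition). $\mathcal{A}$ is simple if it has no congruence relations other than the equality relation and $A\times A$. $\mathbb{N}$ includes $0$; $\nabla^m$, $\Box^n$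 denote iterates; an empty meet is $1$. *)

theory Defs
  imports Main
begin

unbundle lattice_syntax

text \<open>
  The underlying set of an algebra is the type \<open>'a\<close>; the library class \<open>bounded_lattice\<close> allows
  the one-element lattice.
\<close>

locale nabla_algebra =
  fixes nabla :: "'a::bounded_lattice \<Rightarrow> 'a"
    and arrow :: "'a \<Rightarrow> 'a \<Rightarrow> 'a"
  assumes adjunction: "nabla c \<sqinter> a \<le> b \<longleftrightarrow> c \<le> arrow a b"

definition box :: "('a::bounded_lattice \<Rightarrow> 'a \<Rightarrow> 'a) \<Rightarrow> 'a \<Rightarrow> 'a" where
  "box arrow a = arrow \<top> a"

locale distributive_nabla_algebra = nabla_algebra nabla arrow
  for nabla :: "'a::bounded_lattice \<Rightarrow> 'a" and arrow :: "'a \<Rightarrow> 'a \<Rightarrow> 'a" +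
  assumes inf_sup_distributive: "(a::'a) \<sqinter> (b \<squnion> c) = (a \<sqinter> b) \<squnion> (a \<sqinter> c)"

locale normal_nabla_algebra = nabla_algebra nabla arrow
  for nabla :: "'a::bounded_lattice \<Rightarrow> 'a" and arrow :: "'a \<Rightarrow> 'a \<Rightarrow> 'a" +
  assumes nabla_top: "nabla \<top> = \<top>"
    and nabla_inf: "nabla (a \<sqinter> b) = nabla a \<sqinter> nabla b"

locale normal_distributive_nabla_algebra =
  normal_nabla_algebra nabla arrow + distributive_nabla_algebra nabla arrow
  for nabla :: "'a::bounded_lattice \<Rightarrow> 'a" and arrow :: "'a \<Rightarrow> 'a \<Rightarrow> 'a"

locale explicitly_heyting_nabla_algebra = nabla_algebra nabla arrow
  for nabla :: "'a::bounded_lattice \<Rightarrow> 'a" and arrow :: "'a \<Rightarrow> 'a \<Rightarrow> 'a" +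
  fixes himp :: "'a \<Rightarrow> 'a \<Rightarrow> 'a"
  assumes heyting_implication: "c \<sqinter> a \<le> b \<longleftrightarrow> c \<le> himp a b"

locale normal_explicitly_heyting_nabla_algebra =
  normal_nabla_algebra nabla arrow + explicitly_heyting_nabla_algebra nabla arrow himp
  for nabla :: "'a::bounded_lattice \<Rightarrow> 'a" and arrow himp :: "'a \<Rightarrow> 'a \<Rightarrow> 'a"

text \<open>
  Compatibility with the empty meet and join is reflexivity, so the binary operations suffice.
  The definition is also the one for explicitly Heyting algebras: compatibility with the Heyting
  implication is deliberately not required.
\<close>

definition nabla_congruence ::
  "('a::bounded_lattice \<Rightarrow> 'a) \<Rightarrow> ('a \<Rightarrow> 'a \<Rightarrow> 'a) \<Rightarrow> ('a \<times> 'a) set \<Rightarrow> bool" where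
  "nabla_congruence nabla arrow \<theta> \<longleftrightarrow>
     equiv UNIV \<theta> \<and>
     (\<forall>a a' b b'. (a, a') \<in> \<theta> \<longrightarrow> (b, b') \<in> \<theta> \<longrightarrow>
        (a \<sqinter> b, a' \<sqinter> b') \<in> \<theta> \<and>
        (a \<squnion> b, a' \<squnion> b') \<in> \<theta> \<and>
        (arrow a b, arrow a' b') \<in> \<theta>) \<and>
     (\<forall>a a'. (a, a') \<in> \<theta> \<longrightarrow> (nabla a, nabla a') \<in> \<theta>)"

definition nabla_simple :: "('a::bounded_lattice \<Rightarrow> 'a) \<Rightarrow> ('a \<Rightarrow> 'a \<Rightarrow> 'a) \<Rightarrow> bool" where
  "nabla_simple nabla arrow \<longleftrightarrow>
     (\<forall>\<theta>. nabla_congruence nabla arrow \<theta> \<longrightarrow> \<theta> = Id \<or> \<theta> = UNIV \<times> UNIV)"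

text \<open>
  Indexed finite meets in a lattice that need not be complete.  The empty meet is \<open>\<top>\<close>; over
  infinite index sets the value is \<open>\<top>\<close> by convention.
\<close>

global_interpretation finite_meet:
  comm_monoid_set "inf :: 'a::bounded_lattice \<Rightarrow> 'a \<Rightarrow> 'a" "\<top>"
  defines finite_meet = finite_meet.F
  ..

end

theory Submission
  imports Defs
begin

text \<open>
  By normality, \<open>a \<le> b\<close> holds iff \<open>arrow a b = \<top>\<close>. So a congruence \<open>\<theta>\<close> other than equality has
  an element \<open>x \<noteq> \<top>\<close> in its class of \<open>\<top>\<close>, namely some \<open>arrow a b\<close>; this class is closed under
  meets, \<open>nabla\<close> and \<open>box\<close>, so if a meet of elements \<open>nabla^m (box^n x)\<close> is \<open>\<bottom>\<close>, then \<open>\<theta>\<close> is total.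
  Conversely, the meets of such elements generate a filter \<open>F\<close>. It is closed under \<open>nabla\<close> because
  \<open>nabla\<close> preserves meets, and under \<open>box\<close> because \<open>box\<close> is right adjoint to \<open>nabla\<close>, so that
  \<open>nabla^m (box^n x) \<le> box (nabla^(m+1) (box^n x))\<close>. In a distributive algebra, the relation
  \<open>\<exists>f\<in>F. a \<sqinter> f = b \<sqinter> f\<close> is then a congruence identifying \<open>x\<close> and \<open>\<top>\<close>; if it is total, \<open>\<bottom> \<in> F\<close>.
\<close>

section \<open>Finite meets\<close>

lemma le_finite_meet_iff:
  fixes g :: "'i \<Rightarrow> 'a::bounded_lattice"
  assumes "finite I"
  shows "y \<le> finite_meet g I \<longleftrightarrow> (\<forall>i\<in>I. y \<le> g i)"
  using assms by (induction I rule: finite_induct) auto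

text \<open>Numbering \<open>P\<close> from 0 to \<open>card P - 1\<close> turns a meet over any
  finite set into one indexed by naturals, the form used in the theorem.\<close>

lemma finite_meet_reindex_nat:
  fixes g :: "'i \<Rightarrow> 'a::bounded_lattice"
  assumes "finite P"
  obtains I :: "nat set" and h :: "nat \<Rightarrow> 'i"
  where "finite I" "finite_meet (\<lambda>i. g (h i)) I = finite_meet g P"
proof -
  obtain h where "bij_betw h {0..<card P} P"
    using ex_bij_betw_nat_finite[OF assms] by blast
  then have "finite_meet (\<lambda>i. g (h i)) {0..<card P} = finite_meet g P"
    by (rule finite_meet.reindex_bij_betw)
  then show thesis
    using that by blast
qed

section \<open>Consequences of the adjunction\<close>

context nabla_algebra
begin

lemma nabla_mono: "a \<le> b \<Longrightarrow> nabla a \<le> nabla b"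
  using adjunction[of a \<top> "nabla b"] adjunction[of b \<top> "nabla b"]
  by (auto intro: order_trans)

lemma le_box_iff: "c \<le> box arrow b \<longleftrightarrow> nabla c \<le> b"
  unfolding box_def using adjunction[of c \<top> b] by simp

lemma nabla_arrow_inf_le: "nabla (arrow a b) \<sqinter> a \<le> b"
  by (simp add: adjunction)

lemma nabla_box_le: "nabla (box arrow a) \<le> a"
  using le_box_iff by blast

end

section \<open>Filters, their congruences, and the orbit of an element\<close>

definition nabla_filter :: "('a::bounded_lattice \<Rightarrow> 'a) \<Rightarrow> ('a \<Rightarrow> 'a \<Rightarrow> 'a) \<Rightarrow> 'a set \<Rightarrow> bool" where
  "nabla_filter nabla arrow F \<longleftrightarrow>
     \<top> \<in> F \<and>
     (\<forall>a\<in>F. \<forall>b\<in>F. a \<sqinter> b \<in> F) \<and>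
     (\<forall>a\<in>F. \<forall>b. a \<le> b \<longrightarrow> b \<in> F) \<and>
     (\<forall>a\<in>F. nabla a \<in> F \<and> box arrow a \<in> F)"

text \<open>Over a Heyting algebra this relates a and b iff both implications between them lie in
  the filter; the present form is available in every lattice.\<close>

definition filter_congruence :: "'a::bounded_lattice set \<Rightarrow> ('a \<times> 'a) set" where
  "filter_congruence F = {(a, b). \<exists>f\<in>F. a \<sqinter> f = b \<sqinter> f}"

definition orbit_meet ::
  "('a::bounded_lattice \<Rightarrow> 'a) \<Rightarrow> ('a \<Rightarrow> 'a \<Rightarrow> 'a) \<Rightarrow> 'a \<Rightarrow> (nat \<times> nat) set \<Rightarrow> 'a" where
  "orbit_meet nabla arrow x P =
     finite_meet (\<lambda>p. (nabla ^^ fst p) ((box arrow ^^ snd p) x)) P"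

definition orbit_filter ::
  "('a::bounded_lattice \<Rightarrow> 'a) \<Rightarrow> ('a \<Rightarrow> 'a \<Rightarrow> 'a) \<Rightarrow> 'a \<Rightarrow> 'a set" where
  "orbit_filter nabla arrow x = {y. \<exists>P. finite P \<and> orbit_meet nabla arrow x P \<le> y}"

lemma le_orbit_meet_iff:
  "finite P \<Longrightarrow> y \<le> orbit_meet nabla arrow x P \<longleftrightarrow>
     (\<forall>p\<in>P. y \<le> (nabla ^^ fst p) ((box arrow ^^ snd p) x))"
  unfolding orbit_meet_def by (rule le_finite_meet_iff)

lemma orbit_meet_le:
  "finite P \<Longrightarrow> p \<in> P \<Longrightarrow>
     orbit_meet nabla arrow x P \<le> (nabla ^^ fst p) ((box arrow ^^ snd p) x)"
  using le_orbit_meet_iff by blast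

text \<open>From left to right the exponent pairs in \<open>P\<close> are numbered by naturals. From
  right to left several indices may give the same pair, which is harmless because meets are
  idempotent.\<close>

lemma bot_mem_orbit_filter_iff:
  "\<bottom> \<in> orbit_filter nabla arrow x \<longleftrightarrow>
     (\<exists>(I::nat set) (m::nat \<Rightarrow> nat) (n::nat \<Rightarrow> nat). finite I \<and>
       finite_meet (\<lambda>i. (nabla ^^ m i) ((box arrow ^^ n i) x)) I = \<bottom>)"
  (is "?L \<longleftrightarrow> ?R")
proof
  assume ?L
  then obtain P where P: "finite P" "orbit_meet nabla arrow x P = \<bottom>"
    unfolding orbit_filter_def by (auto simp: bot_unique)
  obtain I :: "nat set" and h where "finite I"
    "finite_meet (\<lambda>i. (nabla ^^ fst (h i)) ((box arrow ^^ snd (h i)) x)) I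
       = orbit_meet nabla arrow x P"
    unfolding orbit_meet_def
    by (rule finite_meet_reindex_nat
        [OF P(1), where g = "\<lambda>p. (nabla ^^ fst p) ((box arrow ^^ snd p) x)"])
  then show ?R
    using P(2) by (intro exI[of _ I] exI[of _ "fst \<circ> h"] exI[of _ "snd \<circ> h"]) simp
next
  assume ?R
  then obtain I :: "nat set" and m n where I: "finite I"
    "finite_meet (\<lambda>i. (nabla ^^ m i) ((box arrow ^^ n i) x)) I = \<bottom>"
    by blast
  let ?P = "(\<lambda>i. (m i, n i)) ` I"
  have "orbit_meet nabla arrow x ?P \<le> finite_meet (\<lambda>i. (nabla ^^ m i) ((box arrow ^^ n i) x)) I"
    using I(1) orbit_meet_le[of ?P] by (force simp: le_finite_meet_iff)
  then show ?L
    using I unfolding orbit_filter_def by auto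
qed

context normal_nabla_algebra
begin

lemma arrow_eq_top_iff: "arrow a b = \<top> \<longleftrightarrow> a \<le> b"
  using adjunction[of \<top> a b] by (simp add: nabla_top top_unique)

lemma box_top: "box arrow \<top> = \<top>"
  by (simp add: box_def arrow_eq_top_iff)

lemma nabla_finite_meet: "finite I \<Longrightarrow> nabla (finite_meet g I) = finite_meet (\<lambda>i. nabla (g i)) I"
  by (induction I rule: finite_induct) (simp_all add: nabla_top nabla_inf)

lemma mem_orbit_filter: "x \<in> orbit_filter nabla arrow x"
proof -
  have "orbit_meet nabla arrow x {(0, 0)} \<le> x"
    using orbit_meet_le[of "{(0, 0)}" "(0, 0)" nabla arrow x] by simp
  then show ?thesis
    unfolding orbit_filter_def by blast
qed

lemma nabla_filter_orbit_filter: "nabla_filter nabla arrow (orbit_filter nabla arrow x)"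
proof -
  let ?M = "orbit_meet nabla arrow x"
  have inf: "?M (P \<union> Q) \<le> a \<sqinter> b"
    if "finite P" "finite Q" "?M P \<le> a" "?M Q \<le> b" for P Q a b
  proof -
    have "?M (P \<union> Q) \<le> ?M P" "?M (P \<union> Q) \<le> ?M Q"
      using that by (simp_all add: le_orbit_meet_iff orbit_meet_le)
    then show ?thesis
      using that by (meson le_inf_iff order_trans)
  qed
  \<comment> \<open>Normality moves \<open>nabla\<close> inside the meet, where it raises the first
    exponent of every pair by one.\<close>
  have nabla: "?M (map_prod Suc id ` P) \<le> nabla a" if "finite P" "?M P \<le> a" for P a
  proof -
    have "?M (map_prod Suc id ` P) \<le> nabla (?M P)"
      using orbit_meet_le[of "map_prod Suc id ` P" _ nabla arrow x] that(1)
      by (force simp: orbit_meet_def nabla_finite_meet le_finite_meet_iff)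
    then show ?thesis
      using nabla_mono[OF that(2)] by (rule order_trans)
  qed
  \<comment> \<open>\<open>nabla\<close> undoes the leading \<open>box\<close> when \<open>m = 0\<close>, and supplies the missing \<open>nabla\<close> otherwise.\<close>
  have box: "?M (map_prod (\<lambda>m. m - 1) id ` P \<union> map_prod id Suc ` P) \<le> box arrow a"
    if "finite P" "?M P \<le> a" for P a
  proof -
    \<comment> \<open>Each pair of \<open>P\<close> calls on one of its two images; adding the other
      only lowers the meet. By \<open>le_box_iff\<close> it is enough to bound
      \<open>nabla (?M ?Q)\<close>.\<close>
    let ?Q = "map_prod (\<lambda>m. m - 1) id ` P \<union> map_prod id Suc ` P"
    have fin: "finite ?Q"
      using that(1) by simp
    have "nabla (?M ?Q) \<le> (nabla ^^ fst p) ((box arrow ^^ snd p) x)" if "p \<in> P" for p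
    proof (cases p)
      case (Pair m n)
      show ?thesis
      proof (cases m)
        case 0
        then have "(0, Suc n) \<in> ?Q"
          using Pair that by force
        from nabla_mono[OF orbit_meet_le[OF fin this, of nabla arrow x]]
        have "nabla (?M ?Q) \<le> nabla (box arrow ((box arrow ^^ n) x))"
          by simp
        also have "\<dots> \<le> (box arrow ^^ n) x"
          by (rule nabla_box_le)
        finally show ?thesis
          using 0 Pair by simp
      next
        case (Suc k)
        then have "(k, n) \<in> ?Q"
          using Pair that by force
        from nabla_mono[OF orbit_meet_le[OF fin this, of nabla arrow x]] show ?thesis
          using Suc Pair by simp
      qed
    qed
    then have "nabla (?M ?Q) \<le> ?M P"
      using \<open>finite P\<close> by (simp add: le_orbit_meet_iff)
    then show ?thesis
      using that(2) by (simp add: le_box_iff)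
  qed
  show ?thesis
    unfolding nabla_filter_def orbit_filter_def
  proof (intro conjI ballI allI impI; clarsimp)
    show "\<exists>P :: (nat \<times> nat) set. finite P"
      by blast
  next
    fix a b P Q
    assume "finite P" "?M P \<le> a" "finite Q" "?M Q \<le> b"
    then show "\<exists>R. finite R \<and> ?M R \<le> a \<and> ?M R \<le> b"
      using inf[of P Q a b] by (intro exI[of _ "P \<union> Q"]) simp
  next
    fix a b P
    assume "a \<le> b" "finite P" "?M P \<le> a"
    then show "\<exists>R. finite R \<and> ?M R \<le> b"
      by (meson order_trans)
  next
    fix a P
    assume P: "finite P" "?M P \<le> a"
    then show "\<exists>R. finite R \<and> ?M R \<le> nabla a"
      by (meson nabla finite_imageI)
    show "\<exists>R. finite R \<and> ?M R \<le> box arrow a"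
      using P by (meson box finite_imageI finite_UnI)
  qed
qed

text \<open>All operations involved fix \<top>, by normality in the case of \<open>nabla\<close> and
  \<open>box arrow\<close>. For upward closure, join a \<le> b with b: the left side becomes b, and
  \<top> stays \<top>.\<close>

lemma nabla_filter_top_class:
  assumes "nabla_congruence nabla arrow \<theta>"
  shows "nabla_filter nabla arrow {a. (a, \<top>) \<in> \<theta>}"
proof -
  have refl: "(a, a) \<in> \<theta>" for a
    using assms unfolding nabla_congruence_def equiv_def refl_on_def by blast
  have inf: "(a \<sqinter> b, a' \<sqinter> b') \<in> \<theta>" and sup: "(a \<squnion> b, a' \<squnion> b') \<in> \<theta>"
    and arr: "(arrow a b, arrow a' b') \<in> \<theta>" if "(a, a') \<in> \<theta>" "(b, b') \<in> \<theta>" for a a' b b'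
    using assms that unfolding nabla_congruence_def by blast+
  have nab: "(nabla a, nabla a') \<in> \<theta>" if "(a, a') \<in> \<theta>" for a a'
    using assms that unfolding nabla_congruence_def by blast
  show ?thesis
    unfolding nabla_filter_def
  proof (intro conjI ballI allI impI; unfold mem_Collect_eq)
    show "(\<top>, \<top>) \<in> \<theta>"
      by (rule refl)
  next
    fix a b
    assume "(a, \<top>) \<in> \<theta>" "(b, \<top>) \<in> \<theta>"
    then show "(a \<sqinter> b, \<top>) \<in> \<theta>"
      using inf[of a \<top> b \<top>] by simp
  next
    fix a b
    assume "(a, \<top>) \<in> \<theta>" "a \<le> b"
    then show "(b, \<top>) \<in> \<theta>"
      using sup[of a \<top> b b] refl by (simp add: sup_absorb2)
  next
    fix a
    assume a: "(a, \<top>) \<in> \<theta>"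
    then show "(nabla a, \<top>) \<in> \<theta>"
      using nab[of a \<top>] by (simp add: nabla_top)
    show "(box arrow a, \<top>) \<in> \<theta>"
      using arr[OF refl a, of \<top>] box_top by (simp add: box_def)
  qed
qed

text \<open>Applied to the class of \<top> under a congruence, this carries \<bottom> from the orbit
  filter of \<open>x\<close> into that class.\<close>

lemma orbit_filter_minimal:
  assumes "nabla_filter nabla arrow F" "x \<in> F"
  shows "orbit_filter nabla arrow x \<subseteq> F"
proof -
  have box: "(box arrow ^^ n) x \<in> F" for n
    using assms by (induction n) (auto simp: nabla_filter_def)
  have orbit: "(nabla ^^ m) ((box arrow ^^ n) x) \<in> F" for m n
    using assms(1) box by (induction m) (auto simp: nabla_filter_def)
  have "orbit_meet nabla arrow x P \<in> F" if "finite P" for P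
    using that unfolding orbit_meet_def
    by (induction P rule: finite_induct) (use assms(1) orbit in \<open>auto simp: nabla_filter_def\<close>)
  then show ?thesis
    using assms(1) unfolding orbit_filter_def nabla_filter_def by blast
qed

lemma congruence_eq_Id:
  assumes cong: "nabla_congruence nabla arrow \<theta>"
    and top: "\<And>a. (a, \<top>) \<in> \<theta> \<Longrightarrow> a = \<top>"
  shows "\<theta> = Id"
proof -
  have eq: "equiv UNIV \<theta>"
    using cong by (simp add: nabla_congruence_def)
  then have refl: "(a, a) \<in> \<theta>" for a
    by (auto simp: equiv_def refl_on_def)
  have le: "a \<le> b" if "(a, b) \<in> \<theta>" for a b
  proof -
    \<comment> \<open>Since \<open>arrow b b\<close> is \<top>, triviality of the class of \<top>
      forces \<open>arrow a b\<close> to be \<top>.\<close>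
    have "(arrow a b, arrow b b) \<in> \<theta>"
      using cong that refl unfolding nabla_congruence_def by blast
    then show ?thesis
      using top arrow_eq_top_iff by (metis order_refl)
  qed
  have "a = b" if "(a, b) \<in> \<theta>" for a b
    using le[OF that] le[OF symD[OF _ that]] eq by (auto simp: equiv_def)
  then show ?thesis
    using refl by auto
qed

lemma congruence_eq_UNIV:
  assumes cong: "nabla_congruence nabla arrow \<theta>" and "(\<bottom>, \<top>) \<in> \<theta>"
  shows "\<theta> = UNIV \<times> UNIV"
proof -
  have eq: "equiv UNIV \<theta>"
    using cong by (simp add: nabla_congruence_def)
  have "(a, \<bottom>) \<in> \<theta>" for a
  proof -
    have "(a \<sqinter> \<top>, a \<sqinter> \<bottom>) \<in> \<theta>"
      using cong assms(2) eq unfolding nabla_congruence_def equiv_def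
      by (meson UNIV_I refl_onD symD)
    then show ?thesis
      by simp
  qed
  then show ?thesis
    using eq unfolding equiv_def by (blast dest: symD transD)
qed

end

section \<open>Distributive algebras: from filters to congruences, and simplicity\<close>

context normal_distributive_nabla_algebra
begin

lemma nabla_congruence_filter_congruence:
  assumes F: "nabla_filter nabla arrow F"
  shows "nabla_congruence nabla arrow (filter_congruence F)"
proof -
  let ?C = "filter_congruence F"
  have F_inf: "f \<sqinter> g \<in> F" if "f \<in> F" "g \<in> F" for f g
    using F that by (simp add: nabla_filter_def)
  have restrict: "a \<sqinter> (f \<sqinter> g) = b \<sqinter> (f \<sqinter> g)" "a \<sqinter> (g \<sqinter> f) = b \<sqinter> (g \<sqinter> f)"
    if "a \<sqinter> f = b \<sqinter> f" for a b f g :: 'a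
    using that by (metis inf_assoc inf_commute)+
  \<comment> \<open>Agreement below f persists below any smaller element, so the meet of two
    witnesses serves both pairs.\<close>
  have common: "\<exists>f\<in>F. a \<sqinter> f = a' \<sqinter> f \<and> b \<sqinter> f = b' \<sqinter> f"
    if ab: "(a, a') \<in> ?C" "(b, b') \<in> ?C" for a a' b b'
  proof -
    from ab obtain f g where "f \<in> F" "g \<in> F" "a \<sqinter> f = a' \<sqinter> f" "b \<sqinter> g = b' \<sqinter> g"
      unfolding filter_congruence_def by auto
    then show ?thesis
      using F_inf restrict by blast
  qed
  have "refl ?C"
    using F by (auto simp: refl_on_def filter_congruence_def nabla_filter_def)
  moreover have "sym ?C"
    unfolding sym_def filter_congruence_def by auto metis
  moreover have "trans ?C"
  proof (rule transI)
    fix a b c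
    assume ab: "(a, b) \<in> ?C" and bc: "(b, c) \<in> ?C"
    show "(a, c) \<in> ?C"
      using common[OF ab bc] unfolding filter_congruence_def by auto
  qed
  ultimately have equiv: "equiv UNIV ?C"
    by (simp add: equiv_def)
  have nab: "(nabla a, nabla a') \<in> ?C" if aa': "(a, a') \<in> ?C" for a a'
  proof -
    from aa' obtain f where "f \<in> F" "a \<sqinter> f = a' \<sqinter> f"
      unfolding filter_congruence_def by auto
    then have "nabla f \<in> F" "nabla a \<sqinter> nabla f = nabla a' \<sqinter> nabla f"
      using F by (simp add: nabla_filter_def) (metis \<open>a \<sqinter> f = a' \<sqinter> f\<close> nabla_inf)
    then show ?thesis
      unfolding filter_congruence_def by auto
  qed
  \<comment> \<open>After the adjunction, \<open>nabla (box arrow f)\<close> \<le> \<open>f\<close>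
    makes \<open>f\<close> available, below which \<open>a'\<close> may be replaced by
    \<open>a\<close> and \<open>b\<close> by \<open>b'\<close>. So \<open>box arrow f\<close> is the
    witness for \<open>arrow\<close>.\<close>
  have arrow_le: "arrow a b \<sqinter> box arrow f \<le> arrow a' b'"
    if "a \<sqinter> f = a' \<sqinter> f" "b \<sqinter> f = b' \<sqinter> f" for a a' b b' f
  proof -
    have "nabla (arrow a b \<sqinter> box arrow f) \<sqinter> a' \<le> nabla (arrow a b) \<sqinter> (a' \<sqinter> f)"
      using nabla_box_le[of f] by (simp add: nabla_inf le_infI1 le_infI2)
    also have "\<dots> = nabla (arrow a b) \<sqinter> a \<sqinter> f"
      by (simp add: that(1)[symmetric] inf_assoc)
    also have "\<dots> \<le> b \<sqinter> f"
      using nabla_arrow_inf_le by (rule inf_mono) simp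
    also have "\<dots> \<le> b'"
      by (simp add: that(2))
    finally show ?thesis
      by (simp add: adjunction)
  qed
  have binary: "(a \<sqinter> b, a' \<sqinter> b') \<in> ?C \<and> (a \<squnion> b, a' \<squnion> b') \<in> ?C \<and> (arrow a b, arrow a' b') \<in> ?C"
    if "(a, a') \<in> ?C" "(b, b') \<in> ?C" for a a' b b'
  proof -
    from common[OF that] obtain f
      where f: "f \<in> F" and a: "a \<sqinter> f = a' \<sqinter> f" and b: "b \<sqinter> f = b' \<sqinter> f"
      by blast
    have "(a \<sqinter> b) \<sqinter> f = (a' \<sqinter> b') \<sqinter> f"
      using a b by (metis inf_assoc inf_commute)
    \<comment> \<open>Distributivity enters here: the meet with \<open>f\<close> is taken in each
      joinand.\<close>
    moreover have "(a \<squnion> b) \<sqinter> f = (a' \<squnion> b') \<sqinter> f"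
      using a b by (metis inf_commute inf_sup_distributive)
    moreover have "arrow a b \<sqinter> box arrow f = arrow a' b' \<sqinter> box arrow f"
      using arrow_le[OF a b] arrow_le[OF a[symmetric] b[symmetric]]
      by (intro antisym le_infI) auto
    moreover have "box arrow f \<in> F"
      using F f by (simp add: nabla_filter_def)
    ultimately show ?thesis
      using f unfolding filter_congruence_def by blast
  qed
  show ?thesis
    unfolding nabla_congruence_def using equiv binary nab by blast
qed

lemma nabla_simple_iff:
  "nabla_simple nabla arrow \<longleftrightarrow> (\<forall>x. x \<noteq> \<top> \<longrightarrow> \<bottom> \<in> orbit_filter nabla arrow x)"
proof (intro iffI allI impI)
  fix x :: 'a
  assume simple: "nabla_simple nabla arrow" and x: "x \<noteq> \<top>"
  let ?C = "filter_congruence (orbit_filter nabla arrow x)"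
  have "(x, \<top>) \<in> ?C"
    using mem_orbit_filter[of x] by (force simp: filter_congruence_def)
  with x have "?C \<noteq> Id"
    by auto
  then have "?C = UNIV \<times> UNIV"
    using simple nabla_congruence_filter_congruence[OF nabla_filter_orbit_filter]
    unfolding nabla_simple_def by blast
  then have "(\<bottom>, \<top>) \<in> ?C"
    by simp
  \<comment> \<open>A witness f for this pair satisfies \<bottom> = \<top> \<sqinter> f, hence is
    \<bottom> itself.\<close>
  then show "\<bottom> \<in> orbit_filter nabla arrow x"
    by (auto simp: filter_congruence_def)
next
  assume bot: "\<forall>x. x \<noteq> \<top> \<longrightarrow> \<bottom> \<in> orbit_filter nabla arrow x"
  show "nabla_simple nabla arrow"
    unfolding nabla_simple_def
  proof (intro allI impI)
    fix \<theta>
    assume cong: "nabla_congruence nabla arrow \<theta>"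
    show "\<theta> = Id \<or> \<theta> = UNIV \<times> UNIV"
    proof (cases "\<exists>x. (x, \<top>) \<in> \<theta> \<and> x \<noteq> \<top>")
      case True
      then show ?thesis
        using bot orbit_filter_minimal[OF nabla_filter_top_class[OF cong]]
          congruence_eq_UNIV[OF cong] by blast
    next
      case False
      then show ?thesis
        using congruence_eq_Id[OF cong] by blast
    qed
  qed
qed

end

section \<open>Reduction of the Heyting case to the distributive one\<close>

lemma (in normal_explicitly_heyting_nabla_algebra) normal_distributive:
  "normal_distributive_nabla_algebra nabla arrow"
proof unfold_locales
  fix a b c :: 'a
  \<comment> \<open>Meeting with \<open>a\<close> has the right adjoint \<open>himp a\<close>, hence
    preserves joins.\<close>
  have "b \<squnion> c \<le> himp a ((a \<sqinter> b) \<squnion> (a \<sqinter> c))"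
    by (intro le_supI heyting_implication[THEN iffD1]) (simp_all add: inf_commute)
  then have "(b \<squnion> c) \<sqinter> a \<le> (a \<sqinter> b) \<squnion> (a \<sqinter> c)"
    by (simp only: heyting_implication)
  then have "a \<sqinter> (b \<squnion> c) \<le> (a \<sqinter> b) \<squnion> (a \<sqinter> c)"
    by (simp only: inf_commute)
  then show "a \<sqinter> (b \<squnion> c) = (a \<sqinter> b) \<squnion> (a \<sqinter> c)"
    by (intro antisym distrib_inf_le)
qed

theorem corollary4p14:
  fixes nabla :: "'a::bounded_lattice \<Rightarrow> 'a"
    and arrow himp :: "'a \<Rightarrow> 'a \<Rightarrow> 'a"
  shows
    "(normal_distributive_nabla_algebra nabla arrow \<longrightarrow>
       (nabla_simple nabla arrow \<longleftrightarrow>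
         (\<forall>x. x \<noteq> \<top> \<longrightarrow>
           (\<exists>(I::nat set) (m::nat \<Rightarrow> nat) (n::nat \<Rightarrow> nat). finite I \<and>
             finite_meet (\<lambda>i. (nabla ^^ m i) ((box arrow ^^ n i) x)) I = \<bottom>)))) \<and>
     (normal_explicitly_heyting_nabla_algebra nabla arrow himp \<longrightarrow>
       (nabla_simple nabla arrow \<longleftrightarrow>
         (\<forall>x. x \<noteq> \<top> \<longrightarrow>
           (\<exists>(I::nat set) (m::nat \<Rightarrow> nat) (n::nat \<Rightarrow> nat). finite I \<and>
             finite_meet (\<lambda>i. (nabla ^^ m i) ((box arrow ^^ n i) x)) I = \<bottom>))))"
  \<comment> \<open>Congruences ignore \<open>himp\<close>, so simplicity is the same notion in both
    halves and one criterion settles both.\<close>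
  unfolding bot_mem_orbit_filter_iff[symmetric]
  using normal_distributive_nabla_algebra.nabla_simple_iff
    normal_explicitly_heyting_nabla_algebra.normal_distributive
  by blast

end
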